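(* Using a $(1+\epsilon)$-approximate Euclidean nearest neighbor oracle $\tilde{\mathcal{O}}$, a $(1+\epsilon,R)$-approximate Euclidean near neighbor decision oracle $\widetilde{\mathcal{DO}}$, and a dataset split with multiplicative width $w>1$, Randomized-Spherical-Shell-HyperbolicNN returns, for any query $q$, a point $n_H$ with $d_H(q,n_H)\le\sqrt{w}(1+\epsilon)\,d_H(q,n^* )$, where $n^*$ is the exact hyperbolic nearest neighbor of $q$.
   Context: $\mathbb{H}_r$ is the Poincaré ball (open unit ball of $\mathbb{R}^r$) with distance $d_H(x,y)=\operatorname{arccosh}\left(1+\frac{2\|x-y\|^2}{(1-\|x\|^2)(1-\|y\|^2)}\right)$. Dataset split with width $w$: bucket $B[i]$ consists of data points $x$ with $w^{i-1}\le\frac1{1-\|x\|^2}\le w^i$. $\tilde{\mathcal{O}}(q,P)$ returns some $p\in P$ with $\|p-q\|\le(1+\epsilon)\|q-n\|$, $n$ the Euclidean nearest neighbor of $q$ in $P$. The decision oracle $\widetilde{\mathcal{DO}}(q,R,P)$: if the Euclidean nearest neighbor $n$ of $q$ in $P$ satisfies $\|q-n\|\le R$, it answers YES by returning a certificate $x'\in P$ with $\|x'-q\|\le(1+\epsilon)R$. Randomized-Spherical-Shell-HyperbolicNN: order the buckets by a uniformly random permutation; set $n_H\leftarrow$ NULL and $dist_H\leftarrow\infty$; for each bucket $b$ in this order, set $R\leftarrow\sqrt{\frac{\frac{\cosh(dist_H)-1}{2}(1-\|q\|^2)}{w^b(1+\epsilon)^2}}$; if $dist_H=\infty$ or $\widetilde{\mathcal{DO}}(q,R,B[b])$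 answers YES, compute $n_F\leftarrow\tilde{\mathcal{O}}(q,B[b])$ and, if $d_H(q,n_F)<dist_H$, set $dist_H\leftarrow d_H(q,n_F)$, $n_H\leftarrow n_F$. Return $n_H$. *)

theory Defs
  imports "HOL-Probability.Probability"
begin

definition poincare_ball :: "(real^'r) set" where
  "poincare_ball = ball 0 1"

definition hyp_dist :: "real^'r \<Rightarrow> real^'r \<Rightarrow> real" where
  "hyp_dist x y =
     arcosh (1 + 2 * (norm (x - y))\<^sup>2 / ((1 - (norm x)\<^sup>2) * (1 - (norm y)\<^sup>2)))"

definition nearest_neighbor ::
  "('a \<Rightarrow> 'a \<Rightarrow> real) \<Rightarrow> 'a set \<Rightarrow> 'a \<Rightarrow> 'a \<Rightarrow> bool" where
  "nearest_neighbor d P q n \<longleftrightarrow> is_arg_min (d q) (\<lambda>x. x \<in> P) n"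

definition approx_nn_oracle ::
  "real \<Rightarrow> (real^'r \<Rightarrow> (real^'r) set \<Rightarrow> real^'r) \<Rightarrow> bool" where
  "approx_nn_oracle \<epsilon> NN \<longleftrightarrow>
     (\<forall>q P n. finite P \<longrightarrow> nearest_neighbor dist P q n \<longrightarrow>
        NN q P \<in> P \<and> norm (NN q P - q) \<le> (1 + \<epsilon>) * norm (q - n))"

text \<open>
  The answer YES with certificate \<open>x'\<close> is \<open>Some x'\<close> and the answer NO is \<open>None\<close>.
  If the nearest neighbor is farther away than \<open>R\<close>, the oracle may answer anything.
\<close>
definition approx_near_oracle ::
  "real \<Rightarrow> (real^'r \<Rightarrow> real \<Rightarrow> (real^'r) set \<Rightarrow> (real^'r) option) \<Rightarrow> bool" where
  "approx_near_oracle \<epsilon> DNN \<longleftrightarrow>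
     (\<forall>q R P n. finite P \<longrightarrow> nearest_neighbor dist P q n \<longrightarrow> norm (q - n) \<le> R \<longrightarrow>
        (\<exists>x'\<in>P. DNN q R P = Some x' \<and> norm (x' - q) \<le> (1 + \<epsilon>) * R))"

text \<open>
  Both inequalities are weak, so a point on a common boundary belongs to two buckets.
\<close>
definition bucket :: "real \<Rightarrow> (real^'r) set \<Rightarrow> int \<Rightarrow> (real^'r) set" where
  "bucket w D i =
     {x \<in> D. w powi (i - 1) \<le> 1 / (1 - (norm x)\<^sup>2) \<and> 1 / (1 - (norm x)\<^sup>2) \<le> w powi i}"

text \<open>
  Only nonempty buckets are visited, since the oracles are not specified on the empty set.
\<close>
definition bucket_indices :: "real \<Rightarrow> (real^'r) set \<Rightarrow> int set" where
  "bucket_indices w D = {i. bucket w D i \<noteq> {}}"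

text \<open>
  The state is the pair of \<open>n\<^sub>H\<close> (with NULL as \<open>None\<close>) and \<open>dist\<^sub>H\<close>.
  The value of \<open>R\<close> is irrelevant while \<open>dist\<^sub>H = \<infinity>\<close>: the bucket is then searched regardless of the
  decision oracle.
\<close>
definition process_bucket ::
  "real \<Rightarrow> real \<Rightarrow> (real^'r \<Rightarrow> (real^'r) set \<Rightarrow> real^'r) \<Rightarrow>
   (real^'r \<Rightarrow> real \<Rightarrow> (real^'r) set \<Rightarrow> (real^'r) option) \<Rightarrow>
   (real^'r) set \<Rightarrow> real^'r \<Rightarrow> int \<Rightarrow>
   (real^'r) option \<times> ereal \<Rightarrow> (real^'r) option \<times> ereal" where
  "process_bucket w \<epsilon> NN DNN D q b = (\<lambda>(nH, distH).
     let R = sqrt ((cosh (real_of_ereal distH) - 1) / 2 * (1 - (norm q)\<^sup>2)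
                   / (w powi b * (1 + \<epsilon>)\<^sup>2))
     in if distH = \<infinity> \<or> DNN q R (bucket w D b) \<noteq> None
        then let nF = NN q (bucket w D b)
             in if ereal (hyp_dist q nF) < distH
                then (Some nF, ereal (hyp_dist q nF))
                else (nH, distH)
        else (nH, distH))"

definition randomized_spherical_shell_nn ::
  "real \<Rightarrow> real \<Rightarrow> (real^'r \<Rightarrow> (real^'r) set \<Rightarrow> real^'r) \<Rightarrow>
   (real^'r \<Rightarrow> real \<Rightarrow> (real^'r) set \<Rightarrow> (real^'r) option) \<Rightarrow>
   (real^'r) set \<Rightarrow> real^'r \<Rightarrow> (real^'r) option pmf" where
  "randomized_spherical_shell_nn w \<epsilon> NN DNN D q =
     map_pmf (\<lambda>bs. fst (fold (process_bucket w \<epsilon> NN DNN D q) bs (None, \<infinity>)))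
             (pmf_of_set (permutations_of_set (bucket_indices w D)))"

text \<open>Hence \<open>pmf_of_set\<close> above is applied to a finite nonempty set.\<close>
lemma finite_bucket_indices:
  fixes D :: "(real^'r) set"
  assumes "finite D" "D \<subseteq> poincare_ball" "w > 1"
  shows "finite (bucket_indices w D)"
proof -
  let ?I = "\<lambda>x::real^'r. {i. w powi (i - 1) \<le> 1 / (1 - (norm x)\<^sup>2) \<and> 1 / (1 - (norm x)\<^sup>2) \<le> w powi i}"
  have fin: "finite (?I x)" if "x \<in> D" for x
  proof (rule finite_subset)
    define t where "t = 1 / (1 - (norm x)\<^sup>2)"
    have "norm x < 1"
      using that assms(2) by (auto simp: poincare_ball_def)
    then have "(norm x)\<^sup>2 < 1"
      by (simp add: power_less_one_iff abs_square_less_1)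
    then have t: "t > 0" by (simp add: t_def)
    show "?I x \<subseteq> {\<lfloor>log w t\<rfloor>..\<lfloor>log w t\<rfloor> + 1}"
    proof
      fix i assume "i \<in> ?I x"
      then have le: "w powi (i - 1) \<le> t" "t \<le> w powi i"
        by (auto simp: t_def)
      have pw: "w powi k = w powr (of_int k)" for k
        using assms(3) by (simp add: powr_real_of_int')
      have "of_int (i - 1) \<le> log w t"
        using le(1) t assms(3) unfolding pw by (simp add: le_log_iff)
      moreover have "log w t \<le> of_int i"
        using le(2) t assms(3) unfolding pw by (simp add: log_le_iff)
      ultimately show "i \<in> {\<lfloor>log w t\<rfloor>..\<lfloor>log w t\<rfloor> + 1}"
        by (simp; linarith)
    qed
  qed simp
  have "bucket_indices w D \<subseteq> (\<Union>x\<in>D. ?I x)"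
    by (auto simp: bucket_indices_def bucket_def)
  then show ?thesis
    using fin assms(1) by (meson finite_UN_I finite_subset)
qed

end

(* Put \<Phi>(x) = cosh(d(q, x)) - 1 = 2 |q - x|^2 / ((1 - |q|^2) (1 - |x|^2)) and c = sqrt w (1 + \<epsilon>).
   After the bucket b of nstar has been visited, the current point p satisfies \<Phi>(p) <= c^2 \<Phi>(nstar):
   if the bucket was searched, the Euclidean factor |q - p|^2 grows by at most (1 + \<epsilon>)^2 and the
   factor 1 / (1 - |x|^2) varies within the bucket by at most w; if it was skipped, the decision
   oracle certifies |q - nstar| > R, and R is chosen so that this is the same inequality.
   The distance of the current point never increases, so the inequality survives to the end.
   Finally cosh a - 1 = 2 sinh(a/2)^2, so c sinh t <= sinh (c t) for c >= 1 turns the bound on \<Phi>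
   into a bound on distances. *)
theory Submission
  imports Defs
begin

section \<open>Comparison of hyperbolic sines\<close>

text \<open>The difference of the two sides vanishes at 0, and its derivative
  \<open>c * (cosh (c * x) - cosh x)\<close> is nonnegative because \<open>cosh\<close> increases on
  the nonnegative reals.\<close>

lemma sinh_mult_ge:
  fixes c t :: real
  assumes "c \<ge> 1" "t \<ge> 0"
  shows "c * sinh t \<le> sinh (c * t)"
proof -
  let ?f = "\<lambda>t. sinh (c * t) - c * sinh t"
  have "?f 0 \<le> ?f t"
  proof (rule DERIV_nonneg_imp_nondecreasing[OF assms(2)])
    fix x :: real assume "0 \<le> x" "x \<le> t"
    then have "cosh x \<le> cosh (c * x)"
      using assms mult_right_mono[of 1 c x] by (subst cosh_real_nonneg_le_iff) auto
    then have "0 \<le> c * cosh (c * x) - c * cosh x"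
      using assms by (simp add: mult_left_mono)
    moreover have "(?f has_real_derivative c * cosh (c * x) - c * cosh x) (at x)"
      by (auto intro!: derivative_eq_intros)
    ultimately show "\<exists>y. (?f has_real_derivative y) (at x) \<and> 0 \<le> y" by blast
  qed
  then show ?thesis by simp
qed

lemma cosh_minus_one: "cosh a - 1 = 2 * (sinh (a / 2))\<^sup>2" for a :: real
  using cosh_double[of "a / 2"] cosh_square_eq[of "a / 2"] by simp

text \<open>The half-angle identity turns the hypothesis into a comparison of squares. Roots may be
  taken since \<open>c * sinh (b / 2)\<close> is nonnegative, and monotonicity of
  \<open>sinh\<close> removes it at the end.\<close>

lemma le_mult_of_cosh_le:
  fixes a b c :: real
  assumes "c \<ge> 1" "b \<ge> 0" "cosh a - 1 \<le> c\<^sup>2 * (cosh b - 1)"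
  shows "a \<le> c * b"
proof -
  have "(sinh (a / 2))\<^sup>2 \<le> (c * sinh (b / 2))\<^sup>2"
    using assms(3) by (simp add: cosh_minus_one power_mult_distrib)
  then have "sinh (a / 2) \<le> c * sinh (b / 2)"
    using assms by (auto intro: power2_le_imp_le)
  also have "\<dots> \<le> sinh (c * (b / 2))"
    using assms by (intro sinh_mult_ge) auto
  finally show ?thesis by simp
qed

section \<open>Hyperbolic distance and buckets\<close>

lemma poincare_ball_gap: "x \<in> poincare_ball \<Longrightarrow> 0 < 1 - (norm x)\<^sup>2"
  by (simp add: poincare_ball_def power_less_one_iff abs_square_less_1)

text \<open>Both factors of the denominator are positive in the ball, so the argument of
  \<open>arcosh\<close> is at least 1, where \<open>cosh\<close> inverts it.\<close>

lemma hyp_dist_cosh: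
  assumes "x \<in> poincare_ball" "y \<in> poincare_ball"
  shows "cosh (hyp_dist x y) - 1 = 2 * (norm (x - y))\<^sup>2 / ((1 - (norm x)\<^sup>2) * (1 - (norm y)\<^sup>2))"
    and "hyp_dist x y \<ge> 0"
proof -
  have "0 \<le> 2 * (norm (x - y))\<^sup>2 / ((1 - (norm x)\<^sup>2) * (1 - (norm y)\<^sup>2))"
    using poincare_ball_gap[OF assms(1)] poincare_ball_gap[OF assms(2)] by simp
  then show "cosh (hyp_dist x y) - 1 = 2 * (norm (x - y))\<^sup>2 / ((1 - (norm x)\<^sup>2) * (1 - (norm y)\<^sup>2))"
    "hyp_dist x y \<ge> 0"
    unfolding hyp_dist_def by (simp_all add: arcosh_nonneg_real)
qed

text \<open>On taking logarithms to base \<open>w\<close>, the ceiling of \<open>log w t\<close> is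
  a suitable index. This guarantees that the exact neighbor lies in some visited bucket.\<close>

lemma ex_bucket:
  fixes x :: "real^'r"
  assumes "x \<in> D" "x \<in> poincare_ball" "w > 1"
  shows "\<exists>i. x \<in> bucket w D i"
proof -
  define t where "t = 1 / (1 - (norm x)\<^sup>2)"
  have t: "t > 0" using poincare_ball_gap[OF assms(2)] by (simp add: t_def)
  have pw: "w powi k = w powr (of_int k)" for k
    using assms(3) by (simp add: powr_real_of_int')
  have "w powi (\<lceil>log w t\<rceil> - 1) \<le> t"
  proof -
    have "of_int (\<lceil>log w t\<rceil> - 1) \<le> log w t" by linarith
    then show ?thesis
      unfolding pw using t assms(3) le_log_iff[of w t] by blast
  qed
  moreover have "t \<le> w powi \<lceil>log w t\<rceil>"
    unfolding pw using t assms(3) log_le_iff[of w t] le_of_int_ceiling by blast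
  ultimately show ?thesis using assms(1) by (auto simp: bucket_def t_def)
qed

section \<open>Consequences of the oracle specifications\<close>

lemma ex_nearest_neighbor:
  assumes "finite P" "P \<noteq> {}"
  shows "\<exists>n. nearest_neighbor d P q n"
  using ex_is_arg_min_if_finite[OF assms] by (simp add: nearest_neighbor_def)

lemma nearest_neighborD:
  assumes "nearest_neighbor d P q n"
  shows "n \<in> P" "x \<in> P \<Longrightarrow> d q n \<le> d q x"
  using assms by (auto simp: nearest_neighbor_def is_arg_min_linorder)

text \<open>The hyperbolic nearest neighbor may differ from the Euclidean one in its bucket, so the
  guarantee is extended to every \<open>x\<close> in \<open>P\<close>, which is no closer to
  \<open>q\<close> than the Euclidean nearest neighbor.\<close>

lemma approx_nn_oracleD:
  assumes "approx_nn_oracle \<epsilon> NN" "finite P" "x \<in> P" "\<epsilon> \<ge> 0"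
  shows "NN q P \<in> P" "norm (NN q P - q) \<le> (1 + \<epsilon>) * norm (q - x)"
proof -
  obtain n where n: "nearest_neighbor dist P q n"
    using ex_nearest_neighbor[of P] assms by blast
  have "norm (q - n) \<le> norm (q - x)"
    using nearest_neighborD(2)[OF n assms(3)] by (simp add: dist_norm)
  then have "(1 + \<epsilon>) * norm (q - n) \<le> (1 + \<epsilon>) * norm (q - x)"
    using assms(4) by (intro mult_left_mono) auto
  then show "NN q P \<in> P" "norm (NN q P - q) \<le> (1 + \<epsilon>) * norm (q - x)"
    using assms(1,2) n unfolding approx_nn_oracle_def by force+
qed

text \<open>Contrapositive of the specification: a Euclidean nearest neighbor within
  \<open>R\<close> would force an answer \<open>Some\<close>, so it lies beyond \<open>R\<close>,
  and with it all of \<open>P\<close>.\<close>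

lemma approx_near_oracle_None:
  assumes "approx_near_oracle \<epsilon> DNN" "finite P" "x \<in> P" "DNN q R P = None"
  shows "R < norm (q - x)"
proof -
  obtain n where n: "nearest_neighbor dist P q n"
    using ex_nearest_neighbor[of P] assms by blast
  have "R < norm (q - n)"
    using assms(1,2,4) n unfolding approx_near_oracle_def
    by (metis not_less option.distinct(1))
  also have "\<dots> \<le> norm (q - x)"
    using nearest_neighborD(2)[OF n assms(3)] by (simp add: dist_norm)
  finally show ?thesis .
qed

section \<open>Error within one bucket\<close>

lemma searched_bucket_bound:
  fixes q x y :: "real^'r"
  assumes "D \<subseteq> poincare_ball" "q \<in> poincare_ball" "w > 1" "\<epsilon> \<ge> 0"
    and x: "x \<in> bucket w D b" and y: "y \<in> bucket w D b"
    and le: "norm (y - q) \<le> (1 + \<epsilon>) * norm (q - x)"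
  shows "cosh (hyp_dist q y) - 1 \<le> (sqrt w * (1 + \<epsilon>))\<^sup>2 * (cosh (hyp_dist q x) - 1)"
proof -
  have ball: "x \<in> poincare_ball" "y \<in> poincare_ball"
    using x y assms(1) by (auto simp: bucket_def)
  note gaps = poincare_ball_gap[OF assms(2)] poincare_ball_gap[OF ball(1)] poincare_ball_gap[OF ball(2)]
  \<comment> \<open>The upper end of the bucket's range is \<open>w\<close> times the lower end, so
    the factor at \<open>y\<close> is at most \<open>w\<close> times the factor at
    \<open>x\<close>.\<close>
  have "w powi b = w * w powi (b - 1)"
    using assms(3) power_int_add_1'[of w "b - 1"] by simp
  then have gap: "1 / (1 - (norm y)\<^sup>2) \<le> w * (1 / (1 - (norm x)\<^sup>2))"
    using x y assms(3) unfolding bucket_def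
    by (smt (verit, best) mem_Collect_eq mult_left_mono)
  have "(norm (q - y))\<^sup>2 \<le> ((1 + \<epsilon>) * norm (q - x))\<^sup>2"
    using le by (intro power_mono) (auto simp: norm_minus_commute)
  then have "(norm (q - y))\<^sup>2 * (1 / (1 - (norm y)\<^sup>2))
      \<le> ((1 + \<epsilon>) * norm (q - x))\<^sup>2 * (w * (1 / (1 - (norm x)\<^sup>2)))"
    using gap gaps by (intro mult_mono) auto
  then have "2 / (1 - (norm q)\<^sup>2) * ((norm (q - y))\<^sup>2 * (1 / (1 - (norm y)\<^sup>2)))
      \<le> 2 / (1 - (norm q)\<^sup>2) * (((1 + \<epsilon>) * norm (q - x))\<^sup>2 * (w * (1 / (1 - (norm x)\<^sup>2))))"
    using gaps by (intro mult_left_mono) auto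
  then show ?thesis
    using assms(3) by (simp add: hyp_dist_cosh assms(2) ball power_mult_distrib mult_ac)
qed

lemma skipped_bucket_bound:
  fixes q x :: "real^'r"
  assumes "D \<subseteq> poincare_ball" "q \<in> poincare_ball" "w > 1" "\<epsilon> \<ge> 0"
    and x: "x \<in> bucket w D b"
    and less: "sqrt ((cosh d - 1) / 2 * (1 - (norm q)\<^sup>2) / (w powi b * (1 + \<epsilon>)\<^sup>2)) < norm (q - x)"
  shows "cosh d - 1 \<le> (sqrt w * (1 + \<epsilon>))\<^sup>2 * (cosh (hyp_dist q x) - 1)"
proof -
  have ball: "x \<in> poincare_ball" using x assms(1) by (auto simp: bucket_def)
  note gaps = poincare_ball_gap[OF assms(2)] poincare_ball_gap[OF ball]
  define W where "W = w powi (b - 1)"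
  have W: "W > 0" "w powi b = w * W"
    using assms(3) power_int_add_1'[of w "b - 1"] by (simp_all add: W_def)
  \<comment> \<open>\<open>A\<close> is the square of the approximation constant. Its factor
    \<open>w\<close> comes from splitting \<open>w powi b\<close>, which enters the radius, into
    \<open>w\<close> times the lower end \<open>W\<close> of the bucket's range.\<close>
  define A where "A = w * (1 + \<epsilon>)\<^sup>2"
  have A: "A > 0" using assms(3,4) by (simp add: A_def)
  let ?Rsq = "(cosh d - 1) / 2 * (1 - (norm q)\<^sup>2) / (w powi b * (1 + \<epsilon>)\<^sup>2)"
  have Rsq: "?Rsq \<le> (norm (q - x))\<^sup>2"
    using less by (intro sqrt_le_D) simp
  \<comment> \<open>The formula for the squared radius is solved for
    \<open>cosh d - 1\<close>.\<close>
  have "cosh d - 1 = A * (2 * ?Rsq / (1 - (norm q)\<^sup>2) * W)"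
    using assms(3,4) W(1) gaps unfolding W(2) A_def by simp
  also have "\<dots> \<le> A * (2 * (norm (q - x))\<^sup>2 / (1 - (norm q)\<^sup>2) * W)"
    using A W(1) gaps Rsq by (intro mult_left_mono mult_right_mono divide_right_mono) auto
  also have "\<dots> \<le> A * (2 * (norm (q - x))\<^sup>2 / (1 - (norm q)\<^sup>2) * (1 / (1 - (norm x)\<^sup>2)))"
    using A gaps x by (intro mult_left_mono) (auto simp: bucket_def W_def)
  also have "\<dots> = (sqrt w * (1 + \<epsilon>))\<^sup>2 * (cosh (hyp_dist q x) - 1)"
    using assms(3) by (simp add: hyp_dist_cosh assms(2) ball A_def power_mult_distrib)
  finally show ?thesis .
qed

section \<open>Loop invariant and final bound\<close>

text \<open>Invariant of the loop: it lets a bound on the stored distance be read as a bound for the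
  stored point, and ties NULL to distance \<infinity>.\<close>

definition valid_state :: "(real^'r) set \<Rightarrow> real^'r \<Rightarrow> (real^'r) option \<times> ereal \<Rightarrow> bool" where
  "valid_state D q s \<longleftrightarrow>
     s = (None, \<infinity>) \<or> (\<exists>p\<in>D. s = (Some p, ereal (hyp_dist q p)))"

lemma process_bucket_snd_le: "snd (process_bucket w \<epsilon> NN DNN D q b s) \<le> snd s"
  by (cases s) (auto simp: process_bucket_def Let_def)

lemma fold_process_bucket_snd_le: "snd (fold (process_bucket w \<epsilon> NN DNN D q) bs s) \<le> snd s"
proof (induction bs arbitrary: s)
  case (Cons b bs)
  then show ?case
    using order_trans[OF _ process_bucket_snd_le] by fastforce
qed simp

lemma process_bucket_valid:
  assumes "NN q (bucket w D b) \<in> D" "valid_state D q s"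
  shows "valid_state D q (process_bucket w \<epsilon> NN DNN D q b s)"
  using assms by (cases s) (auto simp: process_bucket_def Let_def valid_state_def)

lemma fold_process_bucket_valid:
  assumes "\<And>b. b \<in> set bs \<Longrightarrow> NN q (bucket w D b) \<in> D" "valid_state D q s"
  shows "valid_state D q (fold (process_bucket w \<epsilon> NN DNN D q) bs s)"
  using assms
proof (induction bs arbitrary: s)
  case (Cons b bs)
  then have "valid_state D q (process_bucket w \<epsilon> NN DNN D q b s)"
    by (intro process_bucket_valid) auto
  with Cons show ?case by simp
qed simp

text \<open>The state before the visit is any valid one, so the bound does not depend on the
  position of the bucket in the random order.\<close>

lemma process_bucket_bound:
  fixes q x :: "real^'r"
  assumes "finite D" "D \<subseteq> poincare_ball" "q \<in> poincare_ball" "w > 1" "\<epsilon> \<ge> 0"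
    and NN: "approx_nn_oracle \<epsilon> NN" and DNN: "approx_near_oracle \<epsilon> DNN"
    and x: "x \<in> bucket w D b" and s: "valid_state D q s"
  shows "snd (process_bucket w \<epsilon> NN DNN D q b s) \<le> ereal (sqrt w * (1 + \<epsilon>) * hyp_dist q x)"
proof -
  define P where "P = bucket w D b"
  define y where "y = NN q P"
  define R where "R = sqrt ((cosh (real_of_ereal (snd s)) - 1) / 2 * (1 - (norm q)\<^sup>2)
                   / (w powi b * (1 + \<epsilon>)\<^sup>2))"
  have P: "finite P" "x \<in> P" "x \<in> poincare_ball"
    using assms(1,2) x by (auto simp: P_def bucket_def)
  have "sqrt w \<ge> 1" using assms(4) by simp
  then have c: "sqrt w * (1 + \<epsilon>) \<ge> 1"
    using assms(5) mult_mono[of 1 "sqrt w" 1 "1 + \<epsilon>"] by simp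
  note concl = le_mult_of_cosh_le[OF c hyp_dist_cosh(2)[OF assms(3) P(3)]]
  show ?thesis
  proof (cases "snd s = \<infinity> \<or> DNN q R P \<noteq> None")
    case True
    have y: "hyp_dist q y \<le> sqrt w * (1 + \<epsilon>) * hyp_dist q x"
      using approx_nn_oracleD[OF NN P(1,2) assms(5), of q] x
      unfolding y_def P_def
      by (intro concl searched_bucket_bound[OF assms(2-5)]) auto
    \<comment> \<open>After a search the stored distance is the minimum of the old one and that of
      \<open>y\<close>.\<close>
    have "snd (process_bucket w \<epsilon> NN DNN D q b s) \<le> ereal (hyp_dist q y)"
      using True by (cases s) (auto simp: process_bucket_def Let_def y_def P_def R_def)
    also have "\<dots> \<le> ereal (sqrt w * (1 + \<epsilon>) * hyp_dist q x)"
      using y by simp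
    finally show ?thesis .
  next
    case False
    \<comment> \<open>The stored distance is finite here, so the invariant supplies a point
      \<open>p\<close> whose actual distance determines \<open>R\<close>.\<close>
    then obtain p where p: "s = (Some p, ereal (hyp_dist q p))"
      using s by (auto simp: valid_state_def)
    have "R < norm (q - x)"
      using False by (intro approx_near_oracle_None[OF DNN P(1,2)]) auto
    then have "hyp_dist q p \<le> sqrt w * (1 + \<epsilon>) * hyp_dist q x"
      unfolding R_def p by (intro concl skipped_bucket_bound[OF assms(2-5) x]) simp
    then show ?thesis
      using process_bucket_snd_le[of w \<epsilon> NN DNN D q b s] p
      by (auto intro: order_trans)
  qed
qed

lemma fold_process_bucket_bound:
  fixes q x :: "real^'r"
  assumes "finite D" "D \<subseteq> poincare_ball" "q \<in> poincare_ball" "w > 1" "\<epsilon> \<ge> 0"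
    and "approx_nn_oracle \<epsilon> NN" "approx_near_oracle \<epsilon> DNN"
    and "x \<in> bucket w D b" "b \<in> set bs" "set bs \<subseteq> bucket_indices w D"
  shows "\<exists>p\<in>D. fst (fold (process_bucket w \<epsilon> NN DNN D q) bs (None, \<infinity>)) = Some p \<and>
           hyp_dist q p \<le> sqrt w * (1 + \<epsilon>) * hyp_dist q x"
proof -
  let ?f = "process_bucket w \<epsilon> NN DNN D q"
  \<comment> \<open>Visited buckets are nonempty, so the oracle's answer is constrained.\<close>
  have NN: "NN q (bucket w D i) \<in> D" if "i \<in> set bs" for i
  proof -
    obtain z where "z \<in> bucket w D i"
      using \<open>i \<in> set bs\<close> assms(10) by (auto simp: bucket_indices_def)
    then have "NN q (bucket w D i) \<in> bucket w D i"
      using assms(1,5,6) by (intro approx_nn_oracleD(1)) (auto simp: bucket_def)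
    then show ?thesis by (simp add: bucket_def)
  qed
  have init: "valid_state D q (None, \<infinity>)" by (simp add: valid_state_def)
  obtain us vs where bs: "bs = us @ b # vs" using assms(9) by (meson split_list)
  have "valid_state D q (fold ?f us (None, \<infinity>))"
    using NN bs by (intro fold_process_bucket_valid init) auto
  then have "snd (?f b (fold ?f us (None, \<infinity>))) \<le> ereal (sqrt w * (1 + \<epsilon>) * hyp_dist q x)"
    by (intro process_bucket_bound assms)
  then have "snd (fold ?f bs (None, \<infinity>)) \<le> ereal (sqrt w * (1 + \<epsilon>) * hyp_dist q x)"
    unfolding bs by (auto intro: order_trans fold_process_bucket_snd_le)
  moreover have "valid_state D q (fold ?f bs (None, \<infinity>))"
    using NN by (intro fold_process_bucket_valid init) auto
  \<comment> \<open>A finite bound excludes the state \<open>(None, \<infinity>)\<close>, so a point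
    is returned.\<close>
  ultimately show ?thesis by (auto simp: valid_state_def)
qed

theorem theorem4:
  fixes D :: "(real^'r) set" and q nstar :: "real^'r" and w \<epsilon> :: real
    and NN :: "real^'r \<Rightarrow> (real^'r) set \<Rightarrow> real^'r"
    and DNN :: "real^'r \<Rightarrow> real \<Rightarrow> (real^'r) set \<Rightarrow> (real^'r) option"
  assumes "finite D" and "D \<subseteq> poincare_ball" and "q \<in> poincare_ball"
    and "w > 1" and "\<epsilon> \<ge> 0"
    and "approx_nn_oracle \<epsilon> NN" and "approx_near_oracle \<epsilon> DNN"
    and "nearest_neighbor hyp_dist D q nstar"
  shows "\<forall>res \<in> set_pmf (randomized_spherical_shell_nn w \<epsilon> NN DNN D q).
           \<exists>nH \<in> D. res = Some nH \<and>
             hyp_dist q nH \<le> sqrt w * (1 + \<epsilon>) * hyp_dist q nstar"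
proof -
  have fin: "finite (bucket_indices w D)"
    using assms by (intro finite_bucket_indices)
  have "nstar \<in> D" using nearest_neighborD(1)[OF assms(8)] .
  then obtain b where b: "nstar \<in> bucket w D b"
    using ex_bucket assms(2,4) by blast
  then have "b \<in> bucket_indices w D" by (auto simp: bucket_indices_def)
  \<comment> \<open>The possible outcomes are exactly the permutations of the index set. Each of
    them contains \<open>b\<close>, so the bound holds for every outcome.\<close>
  moreover have "set_pmf (pmf_of_set (permutations_of_set (bucket_indices w D)))
      = permutations_of_set (bucket_indices w D)"
    using fin by (intro set_pmf_of_set) auto
  ultimately show ?thesis
    unfolding randomized_spherical_shell_nn_def
    using fold_process_bucket_bound[OF assms(1-7) b]
    by (auto dest: permutations_of_setD(1))
qed

end
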